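(* Let $S$ be a monoid satisfying the following conditions: (i) there is $N$ such that for each $n\ge N$, $S$ satisfies the identity $x_1x_2\cdots x_n\,y_1y_2\cdots y_n\,x_n\cdots x_2x_1\,y_n\cdots y_2y_1\approx y_1\cdots y_n\,x_1\cdots x_n\,y_n\cdots y_1\,x_n\cdots x_1$; (ii) for all integers $m,c\ge0$ with $m+c>0$ and every identity $x^mtx^c\approx\mathbf v$ satisfied by $S$ (with $x\neq t$ variables), the set $\{{}_{1}x,\,t\}$ of occurrences in $x^mtx^c$ (the first occurrence of $x$ and the occurrence of $t$) is $l_{x^mtx^c,\mathbf v}$-stable in $x^mtx^c\approx\mathbf v$; (iii) for all $m,c>1$, every word $\mathbf w$ such that $S$ satisfies $x^my^c\approx\mathbf w$ is of the form $x^iy^j$ for some $i,j>1$; (iv) for all $m,c>0$ and $d>1$, every word $\mathbf w$ such that $S$ satisfies $x^my^dx^c\approx\mathbf w$ is of the form $x^iy^jx^k$ for some $i,k>0$ and $j>1$. Then $S$ is non-finitely based.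
   Context: Variables are letters of a countably infinite alphabet $\mathfrak A$, words are elements of the free semigroup $\mathfrak A^+$; a monoid $S$ satisfies $\mathbf u\approx\mathbf v$ if $\varphi(\mathbf u)=\varphi(\mathbf v)$ for all homomorphisms $\varphi:\mathfrak A^+\to S$. $S$ is finitely based if all its identities are derivable from a finite subset of them; otherwise non-finitely based. For a word $\mathbf u$: $\mathrm{occ}_{\mathbf u}(x)$ is the number of occurrences of $x$; ${}_{i\mathbf u}x$ is the $i$-th occurrence of $x$ in $\mathbf u$; $\mathrm{ocs}(\mathbf u)$ is the set of all occurrences of variables in $\mathbf u$, totally ordered by position ($<_{\mathbf u}$). For words $\mathbf u,\mathbf v$ sharing a variable, $l_{\mathbf u,\mathbf v}$ is the map from $\{{}_{i\mathbf u}x: i\le\min(\mathrm{occ}_{\mathbf u}(x),\mathrm{occ}_{\mathbf v}(x))\}$ to $\mathrm{ocs}(\mathbf v)$ given by ${}_{i\mathbf u}x\mapsto{}_{i\mathbf v}x$. A set $X\subseteq\mathrm{ocs}(\mathbf u)$ is $l_{\mathbf u,\mathbf v}$-stable in $\mathbf u\approx\mathbf v$ if $l_{\mathbf u,\mathbf v}$ is defined on $X$ and is an order isomorphism from $(X,<_{\mathbf u})$ onto $(l_{\mathbf u,\mathbf v}(X),<_{\mathbf v})$. *)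

theory Defs
  imports Main
begin

text \<open>Variables are natural numbers (a countably infinite alphabet); words are
lists of variables. Words of the free semigroup are the nonempty lists.\<close>

definition sat :: "'a::monoid_mult itself \<Rightarrow> nat list \<Rightarrow> nat list \<Rightarrow> bool" where
  "sat S u v \<longleftrightarrow> (\<forall>\<phi> :: nat \<Rightarrow> 'a. prod_list (map \<phi> u) = prod_list (map \<phi> v))"

inductive derivable :: "(nat list \<times> nat list) set \<Rightarrow> nat list \<Rightarrow> nat list \<Rightarrow> bool"
  for \<Sigma> where
  ax: "(u, v) \<in> \<Sigma> \<Longrightarrow> derivable \<Sigma> u v"
| refl: "derivable \<Sigma> u u"
| sym: "derivable \<Sigma> u v \<Longrightarrow> derivable \<Sigma> v u"
| trans: "derivable \<Sigma> u v \<Longrightarrow> derivable \<Sigma> v w \<Longrightarrow> derivable \<Sigma> u w"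
| subst: "derivable \<Sigma> u v \<Longrightarrow> derivable \<Sigma> (concat (map \<sigma> u)) (concat (map \<sigma> v))"
| mult: "derivable \<Sigma> u v \<Longrightarrow> derivable \<Sigma> (a @ u @ b) (a @ v @ b)"

definition finitely_based :: "'a::monoid_mult itself \<Rightarrow> bool" where
  "finitely_based S \<longleftrightarrow>
     (\<exists>\<Sigma>. finite \<Sigma> \<and> (\<forall>(u, v) \<in> \<Sigma>. u \<noteq> [] \<and> v \<noteq> [] \<and> sat S u v) \<and>
          (\<forall>u v. u \<noteq> [] \<longrightarrow> v \<noteq> [] \<longrightarrow> sat S u v \<longrightarrow> derivable \<Sigma> u v))"

text \<open>Occurrences: the pair (x, i) denotes the i-th occurrence of x (i \<ge> 1).\<close>
definition occ :: "nat list \<Rightarrow> nat \<Rightarrow> nat" where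
  "occ w x = count_list w x"

definition pos :: "nat list \<Rightarrow> nat \<Rightarrow> nat \<Rightarrow> nat" where
  "pos w x i = [k \<leftarrow> [0..<length w]. w ! k = x] ! (i - 1)"

definition ocs :: "nat list \<Rightarrow> (nat \<times> nat) set" where
  "ocs w = {(x, i). 1 \<le> i \<and> i \<le> occ w x}"

definition occ_less :: "nat list \<Rightarrow> nat \<times> nat \<Rightarrow> nat \<times> nat \<Rightarrow> bool" where
  "occ_less w a b \<longleftrightarrow> pos w (fst a) (snd a) < pos w (fst b) (snd b)"

text \<open>Domain of l_{u,v}; l_{u,v} maps the i-th occurrence of x in u to the i-th occurrence of x in v.\<close>
definition l_dom :: "nat list \<Rightarrow> nat list \<Rightarrow> (nat \<times> nat) set" where
  "l_dom u v = {(x, i). 1 \<le> i \<and> i \<le> min (occ u x) (occ v x)}"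

definition l_map :: "nat list \<Rightarrow> nat list \<Rightarrow> nat \<times> nat \<Rightarrow> nat \<times> nat" where
  "l_map u v a = a"

definition l_stable :: "nat list \<Rightarrow> nat list \<Rightarrow> (nat \<times> nat) set \<Rightarrow> bool" where
  "l_stable u v X \<longleftrightarrow> X \<subseteq> ocs u \<and> X \<subseteq> l_dom u v \<and>
     (\<forall>a\<in>X. \<forall>b\<in>X. occ_less u a b \<longleftrightarrow> occ_less v (l_map u v a) (l_map u v b))"

end

theory Submission
  imports Defs
begin

text \<open>Let \<open>W\<close> be the left-hand side of (i), with \<open>x\<^sub>i = i\<close> and \<open>y\<^sub>j = n + j\<close> for \<open>i, j < n\<close>, and let \<open>w\<close> be any
word with \<open>W \<approx> w\<close> in \<open>S\<close>. By (iv), for \<open>i < j\<close> the word \<open>w\<close> restricted to \<open>x\<^sub>i, x\<^sub>j\<close> (or to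
\<open>y\<^sub>i, y\<^sub>j\<close>) has the nested shape \<open>x\<^sub>i \<dots> x\<^sub>i x\<^sub>j \<dots> x\<^sub>j x\<^sub>i \<dots> x\<^sub>i\<close>, whereas an \<open>x\<close> and a \<open>y\<close> are never
nested. These two facts force the order of the first occurrences of \<open>x\<^sub>i\<close> and \<open>y\<^sub>j\<close> to be the same for all
\<open>i, j \<ge> 1\<close>: it is determined by the order of the last occurrences of \<open>x\<^bsub>n-1\<^esub>\<close> and \<open>y\<^bsub>n-1\<^esub>\<close>.

Suppose an identity \<open>u \<approx> v\<close> of \<open>S\<close> in fewer than \<open>n - 1\<close> variables is applied to \<open>w\<close> through a substitution \<open>\<sigma>\<close>.
If \<open>z\<close> occurs at least twice in \<open>u\<close>, then by nestedness \<open>\<sigma>(z)\<close> contains at most one of the \<open>x\<^sub>i\<close> and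
at most one of the \<open>y\<^sub>j\<close>. Hence some \<open>x\<^sub>i\<close> and some \<open>y\<^sub>j\<close> with \<open>i, j \<ge> 1\<close> occur only in images of
linear variables. Since \<open>x\<close> and \<open>xt\<close> are isoterms by (iii), \<open>u\<close> and \<open>v\<close> have the same linear
part, so the restriction of \<open>w\<close> to \<open>x\<^sub>i, y\<^sub>j\<close> does not change. Thus the common order is invariant
under identities in few variables, but the two sides of (i) have opposite orders.\<close>

section \<open>Identities under substitution, products and deletion of letters\<close>

lemma sat_refl: "sat S u u"
  and sat_sym: "sat S u v \<Longrightarrow> sat S v u"
  and sat_trans: "sat S u v \<Longrightarrow> sat S v w \<Longrightarrow> sat S u w"
  by (simp_all add: sat_def)

lemma prod_list_concat_map:
  "prod_list (map \<phi> (concat (map \<sigma> u))) = prod_list (map (\<lambda>z. prod_list (map \<phi> (\<sigma> z))) u)"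
  for \<phi> :: "nat \<Rightarrow> 'a::monoid_mult"
  by (induction u) auto

lemma sat_subst: "sat S u v \<Longrightarrow> sat S (concat (map \<sigma> u)) (concat (map \<sigma> v))"
  by (simp add: sat_def prod_list_concat_map)

lemma sat_append: "sat S u v \<Longrightarrow> sat S u' v' \<Longrightarrow> sat S (u @ u') (v @ v')"
  by (simp add: sat_def)

lemma filter_eq_concat: "filter P u = concat (map (\<lambda>z. if P z then [z] else []) u)"
  by (induction u) auto

text \<open>Deleting letters is substituting the empty word for them, which is sound because
  \<open>S\<close> has a unit.\<close>

lemma sat_filter: "sat S u v \<Longrightarrow> sat S (filter P u) (filter P v)"
  unfolding filter_eq_concat by (rule sat_subst)

abbreviation restrict :: "nat \<Rightarrow> nat \<Rightarrow> nat list \<Rightarrow> nat list" where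
  "restrict x y w \<equiv> filter (\<lambda>z. z = x \<or> z = y) w"

lemma restrict_commute: "restrict x y w = restrict y x w"
  by (simp add: disj_commute)

lemma restrict_notin:
  assumes "y \<notin> set w"
  shows "restrict x y w = replicate (count_list w x) x"
  using assms by (induction w) auto

lemma filter_eq_replicate: "filter (\<lambda>z. z = x) w = replicate (count_list w x) x"
  by (induction w) auto

lemma count_list_pos_iff: "0 < count_list w x \<longleftrightarrow> x \<in> set w"
  using count_list_0_iff[of w x] by auto

section \<open>Combinatorics of nested pairs of letters\<close>

definition nested :: "nat \<Rightarrow> nat \<Rightarrow> nat list \<Rightarrow> bool" where
  "nested x y w \<longleftrightarrow> (\<exists>i j k. i > 0 \<and> k > 0 \<and> j > 1 \<and>
     restrict x y w = replicate i x @ replicate j y @ replicate k x)"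

lemma nested_count:
  assumes "nested x y w" "x \<noteq> y"
  shows "count_list w y > 1"
proof -
  have "count_list w y = count_list (restrict x y w) y"
    by (induction w) auto
  moreover have "count_list (replicate i z) y = (if z = y then i else 0)" for i z
    by (induction i) auto
  ultimately show ?thesis
    using assms by (auto simp: nested_def)
qed

lemma nested_surrounds:
  assumes "nested x y (A @ y # B)" "x \<noteq> y"
  shows "x \<in> set A" "x \<in> set B"
proof -
  obtain i j k where ijk: "i > 0" "k > 0"
    "restrict x y A @ y # restrict x y B = replicate i x @ replicate j y @ replicate k x"
    using assms by (auto simp: nested_def)
  show "x \<in> set A"
  proof (rule ccontr)
    assume "x \<notin> set A"
    then have "restrict x y A = replicate (count_list A y) y"
      using restrict_notin[of x A y] by (simp add: disj_commute)
    then have "hd (restrict x y A @ y # restrict x y B) = y"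
      by (cases "count_list A y") auto
    then show False
      using ijk assms(2) by (cases i) auto
  qed
  show "x \<in> set B"
  proof (rule ccontr)
    assume "x \<notin> set B"
    then have "restrict x y B = replicate (count_list B y) y"
      using restrict_notin[of x B y] by (simp add: disj_commute)
    then have "last (restrict x y A @ y # restrict x y B) = y"
      by (cases "count_list B y") auto
    then show False
      using ijk assms(2) by (auto simp: last_append)
  qed
qed

text \<open>In \<open>restrict x y\<close> of the whole word the positions of \<open>y\<close> form
  an interval, so no \<open>x\<close> can stand between two occurrences of \<open>y\<close>.\<close>

lemma nested_convex:
  assumes "nested x y (A @ B @ C)" "x \<noteq> y" "y \<in> set A" "y \<in> set C"
  shows "x \<notin> set B"
proof
  assume "x \<in> set B"
  define A' B' C' where defs: "A' = restrict x y A" "B' = restrict x y B" "C' = restrict x y C"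
  obtain i j k where ijk: "A' @ B' @ C' = replicate i x @ replicate j y @ replicate k x"
    using assms(1) by (auto simp: nested_def defs)
  define L where "L = A' @ B' @ C'"
  have y_iff: "L ! m = y \<longleftrightarrow> i \<le> m \<and> m < i + j" if "m < length L" for m
    using that assms(2) unfolding L_def ijk by (auto simp: nth_append)
  obtain a where a: "a < length A'" "A' ! a = y"
    using assms(3) in_set_conv_nth[of y A'] by (auto simp: defs)
  obtain b where b: "b < length B'" "B' ! b = x"
    using \<open>x \<in> set B\<close> in_set_conv_nth[of x B'] by (auto simp: defs)
  obtain c where c: "c < length C'" "C' ! c = y"
    using assms(4) in_set_conv_nth[of y C'] by (auto simp: defs)
  have "L ! a = y" "L ! (length A' + b) = x" "L ! (length A' + length B' + c) = y"
    using a b c by (auto simp: L_def nth_append)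
  then have "i \<le> a" "length A' + length B' + c < i + j"
    "\<not> (i \<le> length A' + b \<and> length A' + b < i + j)"
    using y_iff[of a] y_iff[of "length A' + b"] y_iff[of "length A' + length B' + c"]
      a b c assms(2) by (auto simp: L_def)
  then show False
    using a(1) b(1) by linarith
qed

text \<open>If \<open>y\<close> precedes \<open>x\<close> in \<open>F\<close>, then the
  \<open>x\<close> of the first copy lies between the \<open>y\<close>s of the two copies; if
  \<open>y\<close> follows \<open>x\<close>, then the \<open>x\<close> of the second copy does. Both
  contradict convexity.\<close>

lemma nested_repeated_factor:
  assumes "nested x y (A @ F @ B @ F @ C)" "x \<noteq> y"
  shows "\<not> (x \<in> set F \<and> y \<in> set F)"
proof (intro notI, elim conjE)
  assume "x \<in> set F" "y \<in> set F"
  then obtain D E where F: "F = D @ x # E"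
    by (meson split_list)
  with \<open>y \<in> set F\<close> assms(2) consider "y \<in> set D" | "y \<in> set E"
    by auto
  then show False
  proof cases
    case 1
    show False
      using nested_convex[of x y "A @ D" "x # E @ B" "D @ x # E @ C"] assms 1 by (simp add: F)
  next
    case 2
    show False
      using nested_convex[of x y "A @ D @ x # E" "B @ D @ [x]" "E @ C"] assms 2 by (simp add: F)
  qed
qed

text \<open>Used with \<open>a = x\<^sub>0\<close>, \<open>b = x\<^sub>i\<close>, \<open>c = x\<^bsub>n-1\<^esub>\<close>, \<open>d = y\<^bsub>n-1\<^esub>\<close>, \<open>e = y\<^sub>j\<close>, and with the roles of \<open>x\<close> and \<open>y\<close>
exchanged. If \<open>c\<close> came last, then between the first \<open>b\<close> and the last \<open>c\<close> there would be every \<open>d\<close> and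
no \<open>a\<close>, so \<open>a\<close> and \<open>d\<close> would be nested.\<close>

lemma nested_last:
  assumes ab: "nested a b w" "a \<noteq> b" and ac: "nested a c w" "a \<noteq> c"
    and bc: "b = c \<or> nested b c w" and de: "d = e \<or> nested e d w"
    and ad: "\<not> nested a d w" "a \<noteq> d" and d: "count_list w d > 1" and "c \<noteq> d"
    and first: "hd (restrict b e w) = b" "b \<noteq> e"
  shows "last (restrict c d w) = d"
proof (rule ccontr)
  assume not_d: "last (restrict c d w) \<noteq> d"
  have "c \<in> set w" "b \<in> set w"
    using nested_count[OF ac] nested_count[OF ab] count_notin by fastforce+
  then obtain P z Q where w1: "w = P @ z # Q" "z = c \<or> z = d" "\<forall>z \<in> set Q. \<not> (z = c \<or> z = d)"
    using split_list_last_prop[of w "\<lambda>z. z = c \<or> z = d"] by blast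
  then have "restrict c d Q = []"
    by (auto simp: filter_empty_conv)
  with w1 not_d have "z = c"
    by auto
  obtain A z' B where w2: "w = A @ z' # B" "z' = b \<or> z' = e" "\<forall>z \<in> set A. \<not> (z = b \<or> z = e)"
    using split_list_first_prop[of w "\<lambda>z. z = b \<or> z = e"] \<open>b \<in> set w\<close> by blast
  then have "restrict b e A = []"
    by (auto simp: filter_empty_conv)
  with w2 first have "z' = b"
    by auto
  have Q: "c \<notin> set Q" "d \<notin> set Q" and A: "b \<notin> set A" "e \<notin> set A"
    using w1 w2 by auto
  \<comment> \<open>A \<open>d\<close> before the first \<open>b\<close> would have an
    \<open>e\<close> before it, or be \<open>e\<close> itself, but \<open>A\<close> ends before any
    \<open>b\<close> or \<open>e\<close>.\<close>
  have "d \<notin> set A"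
  proof
    assume "d \<in> set A"
    then obtain A1 A2 where "A = A1 @ d # A2"
      by (meson split_list)
    moreover from this A de have "e \<noteq> d" "nested e d w"
      using \<open>d \<in> set A\<close> by auto
    ultimately show False
      using nested_surrounds(1)[of e d A1 "A2 @ b # B"] w2 A \<open>z' = b\<close> by auto
  qed
  have "a \<in> set A"
    using nested_surrounds(1)[of a b A B] ab w2 \<open>z' = b\<close> by simp
  have "a \<in> set Q"
    using nested_surrounds(2)[of a c P Q] ac w1 \<open>z = c\<close> by simp
  have b_PQ: "b \<in> set P \<and> b \<in> set Q" if "b \<noteq> c"
    using nested_surrounds[of b c P Q] that bc w1 \<open>z = c\<close> by simp
  have "A @ b # B = P @ c # Q"
    using w1 w2 \<open>z = c\<close> \<open>z' = b\<close> by simp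
  \<comment> \<open>The first \<open>b\<close> and the last \<open>c\<close> coincide, come in this
    order, or come in the reverse order. The last is impossible: it puts a \<open>b\<close> into
    \<open>A\<close>.\<close>
  then consider "A = P" "b = c" | M where "P = A @ b # M" | M where "A = P @ c # M" "Q = M @ b # B"
    by (auto simp: append_eq_append_conv2 Cons_eq_append_conv append_eq_Cons_conv)
  then obtain M where M: "w = A @ M @ Q" "a \<notin> set M"
  proof cases
    case 1
    then show thesis
      using that[of "[c]"] w1 \<open>z = c\<close> ac(2) by simp
  next
    case (2 M)
    have "a \<notin> set M"
    proof (cases "b = c")
      case True
      then show ?thesis
        using nested_convex[of a c "A @ [b]" M "c # Q"] ac w1 2 \<open>z = c\<close> by simp
    next
      case False
      then show ?thesis
        using nested_convex[of a b "A @ [b]" M "c # Q"] ab b_PQ w1 2 \<open>z = c\<close> by simp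
    qed
    then show thesis
      using that[of "b # M @ [c]"] 2 w1 \<open>z = c\<close> ab(2) ac(2) by simp
  next
    case (3 M)
    then show thesis
      using A Q b_PQ by (cases "b = c") auto
  qed
  \<comment> \<open>All occurrences of \<open>d\<close> lie in \<open>M\<close> and none of
    \<open>a\<close> does, while \<open>A\<close> and \<open>Q\<close> both contain
    \<open>a\<close>: this is the forbidden nesting of \<open>a\<close> and
    \<open>d\<close>.\<close>
  have "restrict a d w = replicate (count_list A a) a @ replicate (count_list M d) d @
      replicate (count_list Q a) a"
    using restrict_notin[OF \<open>d \<notin> set A\<close>, of a] restrict_notin[OF \<open>d \<notin> set Q\<close>, of a]
      restrict_notin[OF \<open>a \<notin> set M\<close>, of d] by (simp add: M(1) disj_commute)
  moreover have "count_list M d > 1"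
    using d \<open>d \<notin> set A\<close> \<open>d \<notin> set Q\<close> by (simp add: M(1) count_notin)
  ultimately show False
    using ad(1) \<open>a \<in> set A\<close> \<open>a \<in> set Q\<close> unfolding nested_def
    by (metis count_list_0_iff not_gr_zero)
qed

section \<open>Words without repeated letters and linear parts\<close>

lemma restrict_distinct:
  assumes "distinct w" "x \<in> set w" "y \<in> set w" "x \<noteq> y"
  shows "restrict x y w = [x, y] \<or> restrict x y w = [y, x]"
proof -
  have one: "filter (\<lambda>z. z = a) v = [a]" if "distinct v" "a \<in> set v" for a and v :: "nat list"
    using that by (induction v) (auto simp: filter_empty_conv)
  show ?thesis
    using assms(1-3)
  proof (induction w)
    case (Cons a w)
    consider "a = x" | "a = y" | "a \<noteq> x" "a \<noteq> y"
      by blast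
    then show ?case
    proof cases
      case 1
      then have "restrict x y w = filter (\<lambda>z. z = y) w"
        using Cons.prems by (intro filter_cong) auto
      then show ?thesis
        using 1 Cons.prems one[of w y] assms(4) by simp
    next
      case 2
      then have "restrict x y w = filter (\<lambda>z. z = x) w"
        using Cons.prems by (intro filter_cong) auto
      then show ?thesis
        using 2 Cons.prems one[of w x] assms(4) by simp
    next
      case 3
      then show ?thesis
        using Cons by simp
    qed
  qed simp
qed

text \<open>If the first letters differed, restricting to these two letters would tell the words
  apart; equal first letters are cancelled.\<close>

lemma distinct_eqI_restrict:
  assumes "distinct xs" "distinct ys" "set xs = set ys"
    and "\<And>x y. x \<in> set xs \<Longrightarrow> y \<in> set xs \<Longrightarrow> x \<noteq> y \<Longrightarrow> restrict x y xs = restrict x y ys"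
  shows "xs = ys"
  using assms
proof (induction xs arbitrary: ys)
  case Nil
  then show ?case by simp
next
  case (Cons x xs)
  then obtain y ys' where ys: "ys = y # ys'"
    by (cases ys) auto
  have "x = y"
  proof (rule ccontr)
    assume "x \<noteq> y"
    then have "restrict x y (x # xs) = restrict x y ys"
      using Cons.prems by (intro Cons.prems(4)) (auto simp: ys)
    with \<open>x \<noteq> y\<close> show False
      by (simp add: ys)
  qed
  have "xs = ys'"
  proof (rule Cons.IH)
    show "set xs = set ys'"
      using Cons.prems(1-3) \<open>x = y\<close> by (auto simp: ys)
    fix a b
    assume "a \<in> set xs" "b \<in> set xs" "a \<noteq> b"
    then show "restrict a b xs = restrict a b ys'"
      using Cons.prems(1) Cons.prems(4)[of a b] \<open>x = y\<close> by (auto simp: ys split: if_splits)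
  qed (use Cons.prems ys in auto)
  with \<open>x = y\<close> ys show ?case
    by simp
qed

abbreviation linear_part :: "nat list \<Rightarrow> nat list" where
  "linear_part u \<equiv> filter (\<lambda>z. count_list u z = 1) u"

lemma distinct_linear_part: "distinct (linear_part u)"
proof -
  have "count_list (linear_part u) x \<le> 1" for x
  proof -
    have "count_list (filter P w) x \<le> count_list w x" for P w
      by (induction w) auto
    moreover have "count_list (filter P w) x = 0" if "\<not> P x" for P w
      using that by (induction w) auto
    ultimately show ?thesis
      by (cases "count_list u x = 1") (metis, simp)
  qed
  moreover have "(\<forall>x. count_list w x \<le> 1) \<Longrightarrow> distinct w" for w :: "nat list"
  proof (induction w)
    case (Cons a w)
    have "count_list w a = 0"
      using Cons.prems[rule_format, of a] by simp
    moreover have "count_list w x \<le> 1" for x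
      using Cons.prems[rule_format, of x] by (simp split: if_splits)
    ultimately show ?case
      using Cons.IH by (simp add: count_list_0_iff)
  qed simp
  ultimately show ?thesis by blast
qed

section \<open>The word of (i), and letters missed by repeated variables\<close>

definition xyxy_word :: "nat \<Rightarrow> nat list" where
  "xyxy_word n = [0..<n] @ [n..<2*n] @ rev [0..<n] @ rev [n..<2*n]"

lemma restrict_upt:
  assumes "x < y"
  shows "restrict x y [a..<b] = (if a \<le> x \<and> x < b then [x] else []) @ (if a \<le> y \<and> y < b then [y] else [])"
  using assms by (induction b) auto

lemma restrict_xyxy_word:
  "i < j \<Longrightarrow> j < n \<Longrightarrow> restrict i j (xyxy_word n) = [i, j, j, i]"
  "i < j \<Longrightarrow> j < n \<Longrightarrow> restrict (n + i) (n + j) (xyxy_word n) = [n + i, n + j, n + j, n + i]"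
  "i < n \<Longrightarrow> j < n \<Longrightarrow> restrict i (n + j) (xyxy_word n) = [i, n + j, i, n + j]"
  by (auto simp: xyxy_word_def restrict_upt simp flip: rev_filter)

text \<open>Otherwise each of the \<open>n - 1\<close> positive indices \<open>i\<close> has a
  repeated variable \<open>f i\<close> whose image contains \<open>c + i\<close>. The image is a
  repeated factor, so it contains no two of these letters; hence \<open>f\<close> is injective into
  the too small set of variables of \<open>u\<close>.\<close>

lemma nested_uncovered:
  assumes nest: "\<And>i j. i < j \<Longrightarrow> j < n \<Longrightarrow> nested (c + i) (c + j) (a @ concat (map \<sigma> u) @ b)"
    and card: "card (set u) < n - 1"
  obtains i where "0 < i" "i < n" "\<And>z. c + i \<in> set (\<sigma> z) \<Longrightarrow> count_list u z \<le> 1"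
proof (rule ccontr)
  assume "\<not> thesis"
  with that have "\<forall>i \<in> {0<..<n}. \<exists>z. c + i \<in> set (\<sigma> z) \<and> count_list u z > 1"
    by (metis greaterThanLessThan_iff not_le)
  then obtain f where f: "\<And>i. i \<in> {0<..<n} \<Longrightarrow> c + i \<in> set (\<sigma> (f i)) \<and> count_list u (f i) > 1"
    by metis
  \<comment> \<open>Nestedness is given only for a smaller outer index, so one inequality is proved
    and equality follows by symmetry.\<close>
  have "i \<ge> j" if ij: "i \<in> {0<..<n}" "j \<in> {0<..<n}" "f i = f j" for i j
  proof (rule ccontr)
    assume "\<not> i \<ge> j"
    have fi: "count_list u (f i) > 1"
      using f ij by blast
    then obtain u1 u2 where u: "u = u1 @ f i # u2" "f i \<notin> set u1"
      using split_list_first[of "f i" u] count_notin by fastforce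
    with fi have "f i \<in> set u2"
      using count_list_pos_iff[of u2 "f i"] by simp
    then obtain u3 u4 where "u2 = u3 @ f i # u4"
      by (meson split_list)
    with u have w: "a @ concat (map \<sigma> u) @ b = (a @ concat (map \<sigma> u1)) @ \<sigma> (f i) @
        concat (map \<sigma> u3) @ \<sigma> (f i) @ (concat (map \<sigma> u4) @ b)"
      by simp
    then show False
      using nested_repeated_factor[OF nest[of i j, unfolded w]] f[of i] f[of j] ij \<open>\<not> i \<ge> j\<close>
      by auto
  qed
  then have "inj_on f {0<..<n}"
    by (metis inj_onI antisym)
  moreover have "f i \<in> set u" if "i \<in> {0<..<n}" for i
    using f[OF that] count_notin[of "f i" u] by fastforce
  ultimately have "card {0<..<n} \<le> card (set u)"
    by (intro card_inj_on_le) auto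
  with card show False by simp
qed

section \<open>Isoterm consequences of (iii) and (iv)\<close>

locale rigid_monoid =
  fixes S :: "'a::monoid_mult itself"
  assumes powers: "\<And>(x::nat) y m c w. x \<noteq> y \<Longrightarrow> m > 1 \<Longrightarrow> c > 1 \<Longrightarrow> w \<noteq> [] \<Longrightarrow>
      sat S (replicate m x @ replicate c y) w \<Longrightarrow>
      \<exists>i j. i > 1 \<and> j > 1 \<and> w = replicate i x @ replicate j y"
    and nest: "\<And>(x::nat) y m c d w. x \<noteq> y \<Longrightarrow> m > 0 \<Longrightarrow> c > 0 \<Longrightarrow> d > 1 \<Longrightarrow> w \<noteq> [] \<Longrightarrow>
      sat S (replicate m x @ replicate d y @ replicate c x) w \<Longrightarrow>
      \<exists>i j k. i > 0 \<and> k > 0 \<and> j > 1 \<and> w = replicate i x @ replicate j y @ replicate k x"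
begin

text \<open>Appending a power of \<open>x\<close> equal to 1 to a product of two squares would yield
  a word ending in the wrong letter for (iii).\<close>

lemma not_sat_power_Nil:
  assumes "m > 0"
  shows "\<not> sat S (replicate m x) []"
proof
  assume "sat S (replicate m x) []"
  then have sat: "sat S (replicate 2 x @ replicate 2 (Suc x)) (([x, x] @ [Suc x, Suc x]) @ replicate m x)"
    by (auto simp: numeral_2_eq_2 sat_def)
  obtain i j where ij: "([x, x] @ [Suc x, Suc x]) @ replicate m x = replicate i x @ replicate j (Suc x)" "j > 1"
    using powers[OF _ _ _ _ sat] by auto
  have "last (([x, x] @ [Suc x, Suc x]) @ replicate m x) = x"
    using assms by simp
  moreover have "last (replicate i x @ replicate j (Suc x)) = Suc x"
    using ij(2) by simp
  ultimately show False
    by (simp only: ij(1))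
qed

lemma sat_set_subset:
  assumes "sat S u v"
  shows "set u \<subseteq> set v"
proof
  fix z
  assume "z \<in> set u"
  show "z \<in> set v"
  proof (rule ccontr)
    assume "z \<notin> set v"
    then have "sat S (replicate (count_list u z) z) []"
      using sat_filter[OF assms, of "\<lambda>a. a = z"] by (simp add: filter_eq_replicate count_notin)
    then show False
      using not_sat_power_Nil[of "count_list u z" z] \<open>z \<in> set u\<close> by (simp add: count_list_pos_iff)
  qed
qed

lemma sat_set_eq: "sat S u v \<Longrightarrow> set u = set v"
  using sat_set_subset sat_sym by blast

text \<open>From \<open>z\<close> equal to a higher power of \<open>z\<close>, multiplication by the
  square of a fresh letter gives an identity whose other side has \<open>z\<close> only once,
  against (iii).\<close>

lemma sat_count_1:
  assumes "sat S u v" "count_list u z = 1"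
  shows "count_list v z = 1"
proof (rule ccontr)
  define k where "k = count_list v z"
  assume "count_list v z \<noteq> 1"
  moreover have "z \<in> set v"
    using sat_set_subset[OF assms(1)] assms(2) count_notin[of z u] by fastforce
  ultimately have "k > 1"
    using count_list_pos_iff[of v z] by (simp add: k_def)
  have "sat S [z] (replicate k z)"
    using sat_filter[OF assms(1), of "\<lambda>a. a = z"] assms(2) by (simp add: filter_eq_replicate k_def)
  then have sat: "sat S (replicate k z @ replicate 2 (Suc z)) ([z] @ replicate 2 (Suc z))"
    by (rule sat_append[OF sat_sym sat_refl])
  obtain i j where ij: "[z] @ replicate 2 (Suc z) = replicate i z @ replicate j (Suc z)" "i > 1"
    using powers[OF _ \<open>k > 1\<close> _ _ sat] by auto
  have "([z] @ replicate 2 (Suc z)) ! 1 = Suc z"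
    by simp
  moreover have "(replicate i z @ replicate j (Suc z)) ! 1 = z"
    using ij(2) by (simp add: nth_append)
  ultimately show False
    by (simp only: ij(1))
qed

lemma sat_count_1_iff: "sat S u v \<Longrightarrow> count_list u z = 1 \<longleftrightarrow> count_list v z = 1"
  using sat_count_1 sat_sym by blast

text \<open>Doubling both letters would commute two squares, against (iii).\<close>

lemma not_sat_swap:
  assumes "x \<noteq> y"
  shows "\<not> sat S [x, y] [y, x]"
proof
  assume "sat S [x, y] [y, x]"
  from sat_subst[OF this, of "\<lambda>z. [z, z]"] have "sat S (replicate 2 x @ replicate 2 y) [y, y, x, x]"
    by (simp add: numeral_2_eq_2)
  from powers[OF assms _ _ _ this] obtain i j where "i > 1" "[y, y, x, x] = replicate i x @ replicate j y"
    by auto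
  then show False
    using assms by (cases i) auto
qed

lemma sat_linear_part:
  assumes "sat S u v"
  shows "linear_part u = linear_part v"
proof (rule distinct_eqI_restrict)
  have lin: "linear_part v = filter (\<lambda>z. count_list u z = 1) v"
    using sat_count_1_iff[OF assms] by simp
  show "set (linear_part u) = set (linear_part v)"
    unfolding lin using sat_set_eq[OF assms] by simp
  fix x y
  assume xy: "x \<in> set (linear_part u)" "y \<in> set (linear_part u)" "x \<noteq> y"
  have "sat S (restrict x y (linear_part u)) (restrict x y (linear_part v))"
    unfolding lin by (intro sat_filter assms)
  moreover have "restrict x y (linear_part u) = [x, y] \<or> restrict x y (linear_part u) = [y, x]"
    using xy by (intro restrict_distinct distinct_linear_part)
  moreover have "restrict x y (linear_part v) = [x, y] \<or> restrict x y (linear_part v) = [y, x]"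
    using xy \<open>set (linear_part u) = set (linear_part v)\<close>
    by (intro restrict_distinct distinct_linear_part) auto
  ultimately show "restrict x y (linear_part u) = restrict x y (linear_part v)"
    using not_sat_swap[OF \<open>x \<noteq> y\<close>] not_sat_swap[of y x] \<open>x \<noteq> y\<close> by (elim disjE) simp_all
qed (rule distinct_linear_part)+

text \<open>Images of repeated variables contain neither \<open>x\<close> nor \<open>y\<close>, so
  the restriction depends only on the linear part, which \<open>u\<close> and \<open>v\<close>
  share.\<close>

lemma restrict_subst_eq:
  assumes "sat S u v"
    and uncovered: "\<And>z. x \<in> set (\<sigma> z) \<or> y \<in> set (\<sigma> z) \<Longrightarrow> count_list u z \<le> 1"
  shows "restrict x y (concat (map \<sigma> u)) = restrict x y (concat (map \<sigma> v))"
proof -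
  have drop: "restrict x y (concat (map \<sigma> w)) =
      restrict x y (concat (map \<sigma> (filter (\<lambda>z. count_list u z = 1) w)))" if "set w = set u" for w
  proof -
    have "restrict x y (\<sigma> z) = []" if "z \<in> set w" "count_list u z \<noteq> 1" for z
    proof -
      have "count_list u z > 1"
        using that \<open>set w = set u\<close> count_list_0_iff[of u z] by (simp add: nat_neq_iff)
      then show ?thesis
        using uncovered[of z] by (auto simp: filter_empty_conv)
    qed
    then show ?thesis
      by (induction w) simp_all
  qed
  have "linear_part u = filter (\<lambda>z. count_list u z = 1) v"
    using sat_linear_part[OF assms(1)] sat_count_1_iff[OF assms(1)] by simp
  then show ?thesis
    unfolding drop[OF HOL.refl] drop[OF sat_set_eq[OF assms(1), symmetric]] by (rule arg_cong)
qed

section \<open>Nestedness along identities and the invariant order\<close>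

lemma sat_nested:
  assumes "sat S v w" "restrict x y v = [x, y, y, x]" "x \<noteq> y"
  shows "nested x y w"
proof -
  have "sat S (replicate 1 x @ replicate 2 y @ replicate 1 x) (restrict x y w)"
    using sat_filter[OF assms(1), of "\<lambda>z. z = x \<or> z = y"] assms(2) by (simp add: numeral_2_eq_2)
  moreover from sat_set_eq[OF this] have "restrict x y w \<noteq> []"
    by (intro notI) (simp del: set_filter)
  ultimately show ?thesis
    unfolding nested_def using nest[of x y 1 1 2] assms(3) by simp
qed

text \<open>Here (iv) is read backwards: if \<open>w\<close> were nested, (iv) applied to its
  restriction would make the alternating word nested.\<close>

lemma sat_not_nested:
  assumes "sat S v w" "restrict x y v = [x, y, x, y] \<or> restrict x y v = [y, x, y, x]" "x \<noteq> y"
  shows "\<not> nested x y w"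
proof
  assume "nested x y w"
  then obtain i j k where ijk: "i > 0" "k > 0" "j > 1"
    "restrict x y w = replicate i x @ replicate j y @ replicate k x"
    by (auto simp: nested_def)
  then have "sat S (replicate i x @ replicate j y @ replicate k x) (restrict x y v)"
    using sat_sym[OF sat_filter[OF assms(1), of "\<lambda>z. z = x \<or> z = y"]] by simp
  from nest[OF assms(3) _ _ _ _ this] ijk(1-3) assms(2) have "nested x y (restrict x y v)"
    by (auto simp: nested_def)
  moreover have "\<not> nested x y [x, y, x, y]" "\<not> nested x y [y, x, y, x]"
    using nested_surrounds(2)[of x y "[x, y, x]" "[]"] nested_surrounds(1)[of x y "[]" "[x, y, x]"] assms(3)
    by auto
  ultimately show False
    using assms(2) by auto
qed

text \<open>Two uses of \<open>nested_last\<close>, with the roles of the two families exchanged,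
  give the two directions. Positive \<open>i\<close> and \<open>j\<close> leave the letters of index
  0 to serve as the outer letter.\<close>

lemma first_iff_last:
  assumes w: "sat S (xyxy_word n) w" and ij: "0 < i" "i < n" "0 < j" "j < n"
  shows "hd (restrict i (n + j) w) = i \<longleftrightarrow>
    last (restrict (n - 1) (n + (n - 1)) w) = n + (n - 1)"
proof -
  have nx: "nested k l w" if "k < l" "l < n" for k l
    using sat_nested[OF w restrict_xyxy_word(1)[OF that]] that by simp
  have ny: "nested (n + k) (n + l) w" if "k < l" "l < n" for k l
    using sat_nested[OF w restrict_xyxy_word(2)[OF that]] that by simp
  have nn: "\<not> nested k (n + l) w" "\<not> nested (n + l) k w" if "k < n" "l < n" for k l
    using sat_not_nested[OF w, of k "n + l"] sat_not_nested[OF w, of "n + l" k]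
      restrict_xyxy_word(3)[OF that] restrict_commute[of "n + l" k "xyxy_word n"] that by simp_all
  have count: "count_list w k > 1" "count_list w (n + k) > 1" if "0 < k" "k < n" for k
    using nested_count[OF nx[of 0 k]] nested_count[OF ny[of 0 k]] that by auto
  define m where "m = n - 1"
  have m: "0 < m" "m < n" "\<And>k. k < n \<Longrightarrow> k = m \<or> k < m"
    using ij by (auto simp: m_def)
  have to_m: "i = m \<or> nested i m w" "j = m \<or> nested (n + j) (n + m) w"
    using m(3) nx[of i m] ny[of j m] m(2) ij by blast+
  have "last (restrict m (n + m) w) = n + m" if "hd (restrict i (n + j) w) = i"
    using that to_m nx[of 0 i] nx[of 0 m] nn(1)[of 0 m] count(2)[of m] m(1,2) ij
    by (intro nested_last[of 0 i _ _ _ "n + j"]) auto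
  moreover have "last (restrict (n + m) m w) = m" if "hd (restrict (n + j) i w) = n + j"
    using that to_m ny[of 0 j] ny[of 0 m] nn(2)[of m 0] count(1)[of m] m(1,2) ij
    by (intro nested_last[of "n + 0" "n + j" _ _ _ i]) auto
  moreover have "hd (restrict i (n + j) w) = i \<or> hd (restrict (n + j) i w) = n + j"
  proof -
    have "i \<in> set w"
      using count(1)[OF ij(1,2)] count_notin[of i w] by fastforce
    then have "restrict i (n + j) w \<noteq> []"
      by (auto simp: filter_empty_conv)
    from hd_in_set[OF this] show ?thesis
      by (simp add: restrict_commute[of "n + j"])
  qed
  ultimately show ?thesis
    unfolding m_def[symmetric] restrict_commute[of "n + j"] restrict_commute[of "n + m"]
    using m(2) ij(2) by fastforce
qed

text \<open>Some uncovered pair keeps its restriction, hence its first letter. That pair may change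
  from one identity to the next, so the invariant is phrased through the last letters of index
  \<open>n - 1\<close>, which do not depend on it.\<close>

lemma last_invariant:
  assumes uv: "sat S u v" and card: "card (set u) < n - 1"
    and w: "sat S (xyxy_word n) (a @ concat (map \<sigma> u) @ b)"
  shows "last (restrict (n - 1) (n + (n - 1)) (a @ concat (map \<sigma> u) @ b)) = n + (n - 1) \<longleftrightarrow>
    last (restrict (n - 1) (n + (n - 1)) (a @ concat (map \<sigma> v) @ b)) = n + (n - 1)"
proof -
  have w': "sat S (xyxy_word n) (a @ concat (map \<sigma> v) @ b)"
    by (rule sat_trans[OF w]) (intro sat_append sat_subst sat_refl uv)
  obtain i where i: "0 < i" "i < n" "\<And>z. 0 + i \<in> set (\<sigma> z) \<Longrightarrow> count_list u z \<le> 1"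
  proof (rule nested_uncovered[where c = 0, OF _ card])
    show "nested (0 + k) (0 + l) (a @ concat (map \<sigma> u) @ b)" if "k < l" "l < n" for k l
      using sat_nested[OF w restrict_xyxy_word(1)[OF that]] that by simp
  qed (rule that)
  obtain j where j: "0 < j" "j < n" "\<And>z. n + j \<in> set (\<sigma> z) \<Longrightarrow> count_list u z \<le> 1"
  proof (rule nested_uncovered[where c = n, OF _ card])
    show "nested (n + k) (n + l) (a @ concat (map \<sigma> u) @ b)" if "k < l" "l < n" for k l
      using sat_nested[OF w restrict_xyxy_word(2)[OF that]] that by simp
  qed (rule that)
  have "restrict i (n + j) (concat (map \<sigma> u)) = restrict i (n + j) (concat (map \<sigma> v))"
    using i(3) j(3) by (intro restrict_subst_eq uv) auto
  then show ?thesis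
    using first_iff_last[OF w i(1,2) j(1,2)] first_iff_last[OF w' i(1,2) j(1,2)] by simp
qed

text \<open>Quantifying over \<open>a\<close>, \<open>\<sigma>\<close>, \<open>b\<close> lets the
  rules \<open>subst\<close> and \<open>mult\<close> be absorbed into the context. Soundness is
  carried along so that the word stays equal to \<open>xyxy_word n\<close> in
  \<open>S\<close>.\<close>

lemma derivable_invariant:
  assumes "derivable \<Sigma> u v"
    and "\<And>u v. (u, v) \<in> \<Sigma> \<Longrightarrow> sat S u v \<and> card (set u) < n - 1"
  shows "sat S u v \<and> (\<forall>a \<sigma> b. sat S (xyxy_word n) (a @ concat (map \<sigma> u) @ b) \<longrightarrow>
    (last (restrict (n - 1) (n + (n - 1)) (a @ concat (map \<sigma> u) @ b)) = n + (n - 1) \<longleftrightarrow>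
     last (restrict (n - 1) (n + (n - 1)) (a @ concat (map \<sigma> v) @ b)) = n + (n - 1)))"
    (is "_ \<and> (\<forall>a \<sigma> b. ?sat a \<sigma> u b \<longrightarrow> ?inv a \<sigma> u b = ?inv a \<sigma> v b)")
  using assms(1)
proof induction
  case (ax u v)
  then show ?case
    using assms(2) last_invariant by blast
next
  case (refl u)
  then show ?case
    by (simp add: sat_refl)
next
  case (sym u v)
  have "?sat a \<sigma> u b" if "?sat a \<sigma> v b" for a \<sigma> b
    by (rule sat_trans[OF that])
      (intro sat_append sat_subst sat_refl sat_sym[OF sym.IH[THEN conjunct1]])
  with sym.IH show ?case
    using sat_sym by blast
next
  case (trans u v w)
  have "?sat a \<sigma> v b" if "?sat a \<sigma> u b" for a \<sigma> b
    by (rule sat_trans[OF that])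
      (intro sat_append sat_subst sat_refl trans.IH(1)[THEN conjunct1])
  with trans.IH show ?case
    using sat_trans by blast
next
  case (subst u v \<tau>)
  have comp: "concat (map \<sigma> (concat (map \<tau> w))) = concat (map (\<lambda>z. concat (map \<sigma> (\<tau> z))) w)" for w \<sigma>
    by (induction w) auto
  have "?inv a \<sigma> (concat (map \<tau> u)) b = ?inv a \<sigma> (concat (map \<tau> v)) b" if "?sat a \<sigma> (concat (map \<tau> u)) b" for a \<sigma> b
    using that unfolding comp by (rule subst.IH[THEN conjunct2, rule_format])
  with subst.IH show ?case
    using sat_subst by blast
next
  case (mult u v c d)
  have "sat S (c @ u @ d) (c @ v @ d)"
    by (intro sat_append sat_refl mult.IH[THEN conjunct1])
  moreover have "?inv a \<sigma> (c @ u @ d) b = ?inv a \<sigma> (c @ v @ d) b" if "?sat a \<sigma> (c @ u @ d) b" for a \<sigma> b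
    using mult.IH[THEN conjunct2, rule_format, of "a @ concat (map \<sigma> c)" \<sigma> "concat (map \<sigma> d) @ b"] that
    by simp
  ultimately show ?case by blast
qed

end

theorem theorem2p7:
  fixes S :: "'a::monoid_mult itself"
  assumes i: "\<exists>N. \<forall>n\<ge>N. sat S ([0..<n] @ [n..<2*n] @ rev [0..<n] @ rev [n..<2*n])
                                ([n..<2*n] @ [0..<n] @ rev [n..<2*n] @ rev [0..<n])"
    and ii: "\<forall>(x::nat) t m c v. x \<noteq> t \<longrightarrow> m + c > 0 \<longrightarrow> v \<noteq> [] \<longrightarrow>
               sat S (replicate m x @ [t] @ replicate c x) v \<longrightarrow>
               l_stable (replicate m x @ [t] @ replicate c x) v {(x, 1), (t, 1)}"
    and iii: "\<forall>(x::nat) y m c w. x \<noteq> y \<longrightarrow> m > 1 \<longrightarrow> c > 1 \<longrightarrow> w \<noteq> [] \<longrightarrow>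
               sat S (replicate m x @ replicate c y) w \<longrightarrow>
               (\<exists>i j. i > 1 \<and> j > 1 \<and> w = replicate i x @ replicate j y)"
    and iv: "\<forall>(x::nat) y m c d w. x \<noteq> y \<longrightarrow> m > 0 \<longrightarrow> c > 0 \<longrightarrow> d > 1 \<longrightarrow> w \<noteq> [] \<longrightarrow>
               sat S (replicate m x @ replicate d y @ replicate c x) w \<longrightarrow>
               (\<exists>i j k. i > 0 \<and> k > 0 \<and> j > 1 \<and>
                   w = replicate i x @ replicate j y @ replicate k x)"
  shows "\<not> finitely_based S"
proof
  assume "finitely_based S"
  then obtain \<Sigma> where "finite \<Sigma>" and sound: "\<forall>(u, v)\<in>\<Sigma>. u \<noteq> [] \<and> v \<noteq> [] \<and> sat S u v"
    and complete: "\<forall>u v. u \<noteq> [] \<longrightarrow> v \<noteq> [] \<longrightarrow> sat S u v \<longrightarrow> derivable \<Sigma> u v"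
    unfolding finitely_based_def by (elim exE conjE)
  interpret rigid_monoid S
    by unfold_locales ((rule iii[rule_format]; assumption), (rule iv[rule_format]; assumption))
  obtain N where N: "\<And>n. n \<ge> N \<Longrightarrow> sat S ([0..<n] @ [n..<2*n] @ rev [0..<n] @ rev [n..<2*n])
      ([n..<2*n] @ [0..<n] @ rev [n..<2*n] @ rev [0..<n])"
    using i by blast
  \<comment> \<open>The sum bounds the number of variables in each left-hand side of
    \<open>\<Sigma>\<close>; adding 2 makes this number strictly less than
    \<open>n - 1\<close>.\<close>
  define n where "n = N + (\<Sum>e\<in>\<Sigma>. card (set (fst e))) + 2"
  then have n: "N \<le> n" "n - 1 < n" "n > 0"
    by auto
  have card: "card (set u) < n - 1" if "(u, v) \<in> \<Sigma>" for u v
    using member_le_sum[OF that, of "\<lambda>e. card (set (fst e))"] \<open>finite \<Sigma>\<close> by (simp add: n_def)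
  define v where "v = [n..<2*n] @ [0..<n] @ rev [n..<2*n] @ rev [0..<n]"
  have "xyxy_word n \<noteq> []" "v \<noteq> []"
    using n(3) by (simp_all add: xyxy_word_def v_def)
  moreover have "sat S (xyxy_word n) v"
    unfolding xyxy_word_def v_def by (rule N[OF n(1)])
  ultimately have "derivable \<Sigma> (xyxy_word n) v"
    by (rule complete[rule_format])
  \<comment> \<open>The trivial context and the identity substitution compare the two sides of (i)
    themselves.\<close>
  from derivable_invariant[OF this, of n, THEN conjunct2, rule_format, of "[]" "\<lambda>z. [z]" "[]"]
  have "last (restrict (n - 1) (n + (n - 1)) (xyxy_word n)) = n + (n - 1) \<longleftrightarrow>
      last (restrict (n - 1) (n + (n - 1)) v) = n + (n - 1)"
    using sound card sat_refl[of S "xyxy_word n"] by (auto simp only: append.simps append_Nil2 concat_map_singleton map_ident)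
  moreover have "restrict (n - 1) (n + (n - 1)) (xyxy_word n) = [n - 1, n + (n - 1), n - 1, n + (n - 1)]"
    using n(2) by (intro restrict_xyxy_word)
  moreover have "restrict (n - 1) (n + (n - 1)) v = [n + (n - 1), n - 1, n + (n - 1), n - 1]"
    using n(2,3) by (auto simp: v_def restrict_upt simp flip: rev_filter)
  ultimately show False
    using n(3) by simp
qed

end
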